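(* Let $A$ be a unital C*-algebra such that every maximal abelian self-adjoint subalgebra of $A$ is monotone $\sigma$-complete. Then $A$ is a Rickart C*-algebra; more precisely, for each $x\in A$ there is a projection $f\in A$ with $\{z\in A: xz=0\}=fA$.
   Context: A C*-algebra $B$ is monotone $\sigma$-complete if every norm-bounded monotone increasing sequence in $B_{sa}$ has a supremum in $B_{sa}$ (for a maximal abelian self-adjoint subalgebra $M$, suprema are taken in $M_{sa}$). A C*-algebra $B$ is Rickart if for each $a\in B$ there is a projection $p\in B$ such that $\{z\in B: az=0\}=pB$. *)

theory Defs
  imports "HOL-Analysis.Analysis"
begin

class unital_cstar_algebra = real_normed_algebra_1 + banach +
  fixes scaleC :: "complex \<Rightarrow> 'a \<Rightarrow> 'a"
    and invol :: "'a \<Rightarrow> 'a"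
  assumes scaleC_add_left: "scaleC (a + b) x = scaleC a x + scaleC b x"
    and scaleC_add_right: "scaleC a (x + y) = scaleC a x + scaleC a y"
    and scaleC_scaleC: "scaleC a (scaleC b x) = scaleC (a * b) x"
    and scaleC_one: "scaleC 1 x = x"
    and scaleC_of_real: "scaleC (complex_of_real r) x = scaleR r x"
    and norm_scaleC: "norm (scaleC a x) = cmod a * norm x"
    and scaleC_mult_left: "scaleC a x * y = scaleC a (x * y)"
    and scaleC_mult_right: "x * scaleC a y = scaleC a (x * y)"
    and invol_add: "invol (x + y) = invol x + invol y"
    and invol_scaleC: "invol (scaleC a x) = scaleC (cnj a) (invol x)"
    and invol_invol: "invol (invol x) = x"
    and invol_mult: "invol (x * y) = invol y * invol x"
    and cstar_identity: "norm (invol x * x) = (norm x)\<^sup>2"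

context unital_cstar_algebra
begin

definition self_adjoint :: "'a \<Rightarrow> bool" where
  "self_adjoint x \<longleftrightarrow> invol x = x"

definition projection :: "'a \<Rightarrow> bool" where
  "projection p \<longleftrightarrow> p * p = p \<and> invol p = p"

text \<open>Positive elements and the usual order on self-adjoint elements
  (positivity taken in the ambient algebra; it coincides with positivity in any
  C*-subalgebra).\<close>
definition positive :: "'a \<Rightarrow> bool" where
  "positive x \<longleftrightarrow> (\<exists>z. x = invol z * z)"

definition cle :: "'a \<Rightarrow> 'a \<Rightarrow> bool" where
  "cle x y \<longleftrightarrow> positive (y - x)"

definition star_subalgebra :: "'a set \<Rightarrow> bool" where
  "star_subalgebra M \<longleftrightarrow> 0 \<in> M \<and>
     (\<forall>x\<in>M. \<forall>y\<in>M. x + y \<in> M \<and> x * y \<in> M) \<and>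
     (\<forall>a. \<forall>x\<in>M. scaleC a x \<in> M) \<and>
     (\<forall>x\<in>M. invol x \<in> M)"

definition abelian :: "'a set \<Rightarrow> bool" where
  "abelian M \<longleftrightarrow> (\<forall>x\<in>M. \<forall>y\<in>M. x * y = y * x)"

definition masa :: "'a set \<Rightarrow> bool" where
  "masa M \<longleftrightarrow> star_subalgebra M \<and> abelian M \<and>
     (\<forall>N. star_subalgebra N \<and> abelian N \<and> M \<subseteq> N \<longrightarrow> N = M)"

definition monotone_sigma_complete :: "'a set \<Rightarrow> bool" where
  "monotone_sigma_complete M \<longleftrightarrow>
     (\<forall>a :: nat \<Rightarrow> 'a.
        (\<forall>n. a n \<in> M \<and> self_adjoint (a n)) \<and>
        (\<forall>n. cle (a n) (a (Suc n))) \<and>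
        (\<exists>B. \<forall>n. norm (a n) \<le> B)
        \<longrightarrow> (\<exists>s\<in>M. self_adjoint s \<and> (\<forall>n. cle (a n) s) \<and>
               (\<forall>t\<in>M. self_adjoint t \<and> (\<forall>n. cle (a n) t) \<longrightarrow> cle s t)))"

end

end

theory Submission
  imports Defs
begin

text \<open>
  Replace $x$ by a multiple $h$ of $x^*x$ with $\|h\| \le 1$, which has the same right annihilator,
  and let $X$ be the two-sided annihilator of $h$.  Take a maximal abelian *-subalgebra $J$ of $X$
  and a masa $M$ containing $J$ and $h$, so that $M \cap X = J$.  In $M$ the infimum $e$ of the
  decreasing sequence $(1-h^2)^n$ is a projection and the unit of $M \cap X = J$.  If $hz = 0$, then
  $w = (1-e)zz^*(1-e)$ lies in $X$ and annihilates $J$, so $w \in J$ by maximality, whence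
  $w = we = 0$ and $z = ez$.

  The order of $A$ is handled without spectral theory: $x = x^*$ is positive iff
  $\|r - x\| \le r$ for some $r > 0$.  This is visibly closed under sums, and square
  roots are obtained from a fixed-point iteration.
\<close>

section \<open>Square roots and positivity\<close>

lemma scaleC_zero_left: "scaleC 0 (x::'a::unital_cstar_algebra) = 0"
  using scaleC_of_real[of 0 x] by simp

lemma scaleC_minus_one: "scaleC (-1) (x::'a::unital_cstar_algebra) = - x"
  using scaleC_of_real[of "-1" x] by simp

lemma invol_zero [simp]: "invol (0::'a::unital_cstar_algebra) = 0"
  using invol_add[of "0::'a" 0] by simp

lemma invol_minus [simp]: "invol (- x) = - invol (x::'a::unital_cstar_algebra)"
  using invol_add[of x "-x"] by (simp add: eq_neg_iff_add_eq_0 add.commute)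

lemma invol_diff [simp]: "invol (x - y) = invol x - invol (y::'a::unital_cstar_algebra)"
  using invol_add[of x "-y"] by simp

lemma invol_scaleR [simp]: "invol (r *\<^sub>R x) = r *\<^sub>R invol (x::'a::unital_cstar_algebra)"
  using invol_scaleC[of "complex_of_real r" x] by (simp add: scaleC_of_real)

declare invol_add [simp] invol_invol [simp] invol_mult [simp] invol_scaleC [simp]

lemma invol_one [simp]: "invol (1::'a::unital_cstar_algebra) = 1"
  by (metis invol_invol invol_mult mult.left_neutral mult.right_neutral)

lemma norm_invol [simp]: "norm (invol x) = norm (x::'a::unital_cstar_algebra)"
proof -
  have le: "norm y \<le> norm (invol y)" for y :: 'a
  proof (cases "y = 0")
    case False
    have "norm y * norm y \<le> norm (invol y) * norm y"
      using cstar_identity[of y] norm_mult_ineq[of "invol y" y] by (simp add: power2_eq_square)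
    then show ?thesis using False by simp
  qed simp
  show ?thesis using le[of x] le[of "invol x"] by simp
qed

lemma invol_mult_self_eq_0 [simp]: "invol x * x = 0 \<longleftrightarrow> (x::'a::unital_cstar_algebra) = 0"
  using cstar_identity[of x] by auto

lemma norm_square_self_adjoint:
  "self_adjoint (x::'a::unital_cstar_algebra) \<Longrightarrow> norm (x * x) = norm x * norm x"
  using cstar_identity[of x] by (simp add: self_adjoint_def power2_eq_square)

text \<open>The fixed-point iteration $q \mapsto (x + q^2)/2$ for $q = 1 - \sqrt{1-x}$ is dominated
  term by term by the same iteration for the real number $1$, which increases to $1$.\<close>

primrec sqrt_iter :: "'a::real_algebra_1 \<Rightarrow> nat \<Rightarrow> 'a" where
  "sqrt_iter x 0 = 0"
| "sqrt_iter x (Suc n) = (1/2) *\<^sub>R (x + sqrt_iter x n * sqrt_iter x n)"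

lemma sqrt_iter_commute:
  assumes "w * x = x * w"
  shows "w * sqrt_iter x n = sqrt_iter x n * w"
proof (induction n)
  case (Suc n)
  have "w * (sqrt_iter x n * sqrt_iter x n) = sqrt_iter x n * sqrt_iter x n * w"
    by (metis Suc mult.assoc)
  then show ?case using assms by (simp add: distrib_left distrib_right)
qed simp

lemma sqrt_iter_one_bounds: "0 \<le> sqrt_iter (1::real) n \<and> sqrt_iter (1::real) n \<le> 1"
proof (induction n)
  case (Suc n)
  then have "sqrt_iter 1 n * sqrt_iter 1 n \<le> (1::real)" by (simp add: mult_le_one)
  then show ?case using Suc by simp
qed simp

lemma sqrt_iter_one_mono: "sqrt_iter (1::real) n \<le> sqrt_iter 1 (Suc n)"
proof -
  \<comment> \<open>Expanding the square gives \<open>s \<le> (1 + s * s) / 2\<close>, whose right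
    side is the next iterate.\<close>
  have "0 \<le> (1 - sqrt_iter (1::real) n)^2" by simp
  then show ?thesis by (simp add: power2_eq_square algebra_simps)
qed

lemma norm_sqrt_iter_le:
  fixes x :: "'a::real_normed_algebra_1"
  assumes "norm x \<le> 1"
  shows "norm (sqrt_iter x n) \<le> sqrt_iter 1 n"
proof (induction n)
  case (Suc n)
  have "norm (x + sqrt_iter x n * sqrt_iter x n) \<le> norm x + norm (sqrt_iter x n) * norm (sqrt_iter x n)"
    by (meson norm_triangle_le norm_mult_ineq add_left_mono)
  also have "\<dots> \<le> 1 + sqrt_iter 1 n * sqrt_iter 1 n"
    using assms Suc sqrt_iter_one_bounds[of n] by (intro add_mono mult_mono) auto
  finally show ?case by simp
qed simp

text \<open>Iterates commute, so the difference of two squares factors as difference times sum. The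
  first factor is bounded by induction, the second by \<open>norm_sqrt_iter_le\<close>, and the real
  iteration obeys the same recursion with equality.\<close>

lemma norm_sqrt_iter_step:
  fixes x :: "'a::real_normed_algebra_1"
  assumes "norm x \<le> 1"
  shows "norm (sqrt_iter x (Suc n) - sqrt_iter x n) \<le> sqrt_iter 1 (Suc n) - sqrt_iter 1 n"
proof (induction n)
  case 0
  then show ?case using assms by simp
next
  case (Suc n)
  let ?q = "sqrt_iter x" and ?s = "sqrt_iter (1::real)"
  \<comment> \<open>\<open>sqrt_iter_commute\<close> used repeatedly: \<open>x\<close> commutes with
    itself, hence with every iterate, hence any two iterates commute.\<close>
  have comm: "?q (Suc n) * ?q n = ?q n * ?q (Suc n)"
    by (metis sqrt_iter_commute)
  have step: "sqrt_iter z (Suc (Suc n)) - sqrt_iter z (Suc n)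
      = (1/2) *\<^sub>R (sqrt_iter z (Suc n) * sqrt_iter z (Suc n) - sqrt_iter z n * sqrt_iter z n)"
    for z :: "'b::real_normed_algebra_1"
    unfolding sqrt_iter.simps(2)[of z "Suc n"] by (simp add: scaleR_diff_right[symmetric])
  have sq: "(?q (Suc n) - ?q n) * (?q (Suc n) + ?q n) = ?q (Suc n) * ?q (Suc n) - ?q n * ?q n"
    using comm by (simp add: distrib_left left_diff_distrib del: sqrt_iter.simps)
  have "norm (?q (Suc (Suc n)) - ?q (Suc n)) = (1/2) * norm ((?q (Suc n) - ?q n) * (?q (Suc n) + ?q n))"
    unfolding sq step by simp
  also have "\<dots> \<le> (1/2) * (norm (?q (Suc n) - ?q n) * norm (?q (Suc n) + ?q n))"
    by (simp add: norm_mult_ineq del: sqrt_iter.simps)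
  also have "\<dots> \<le> (1/2) * ((?s (Suc n) - ?s n) * (?s (Suc n) + ?s n))"
  proof (intro mult_left_mono mult_mono)
    show "norm (?q (Suc n) + ?q n) \<le> ?s (Suc n) + ?s n"
      using norm_sqrt_iter_le[OF assms] by (meson norm_triangle_le add_mono)
  qed (use Suc sqrt_iter_one_mono[of n] in auto)
  also have "\<dots> = ?s (Suc (Suc n)) - ?s (Suc n)"
    unfolding step by (simp add: algebra_simps del: sqrt_iter.simps)
  finally show ?case .
qed

text \<open>The steps of the bounded increasing real iteration telescope, so they form a summable
  majorant for the steps in the algebra; completeness does the rest.\<close>

lemma convergent_sqrt_iter:
  fixes x :: "'a::{real_normed_algebra_1,banach}"
  assumes "norm x \<le> 1"
  shows "convergent (sqrt_iter x)"
proof -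
  let ?d = "\<lambda>n. sqrt_iter x (Suc n) - sqrt_iter x n"
  have "incseq (sqrt_iter (1::real))" by (rule incseq_SucI) (rule sqrt_iter_one_mono)
  then have "convergent (sqrt_iter (1::real))"
    using sqrt_iter_one_bounds incseq_convergent[of "sqrt_iter 1" 1] unfolding convergent_def by blast
  then have "summable (\<lambda>n. sqrt_iter (1::real) (Suc n) - sqrt_iter 1 n)"
    using telescope_summable[of "sqrt_iter (1::real)"] convergent_LIMSEQ_iff by blast
  then have "summable ?d"
    by (rule summable_comparison_test') (rule norm_sqrt_iter_step[OF assms])
  then have "convergent (\<lambda>n. \<Sum>k<n. ?d k)" by (simp add: summable_iff_convergent)
  then show ?thesis unfolding sum_lessThan_telescope by simp
qed

lemma tendsto_invol:
  fixes f :: "'b \<Rightarrow> 'a::unital_cstar_algebra"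
  assumes "(f \<longlongrightarrow> l) F"
  shows "((\<lambda>n. invol (f n)) \<longlongrightarrow> invol l) F"
proof -
  have "dist (invol y) (invol z) = dist y (z::'a)" for y z
    by (metis dist_norm invol_diff norm_invol)
  then show ?thesis using assms by (simp add: tendsto_iff)
qed

text \<open>A fixed point \<open>q\<close> of the iteration for \<open>1 - y\<close> satisfies
  \<open>q + q = (1 - y) + q * q\<close>, which says that \<open>1 - q\<close> squares to
  \<open>y\<close>. Self-adjointness, the norm bound and commutation hold for each iterate and pass
  to the limit. The commutation clause stands in for functional calculus in what follows.\<close>

lemma sqrt_exists:
  fixes y :: "'a::unital_cstar_algebra"
  assumes sa: "self_adjoint y" and le: "norm (1 - y) \<le> 1"
  obtains p where "self_adjoint p" "p * p = y" "norm (1 - p) \<le> 1"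
    "\<And>w. w * y = y * w \<Longrightarrow> w * p = p * w"
proof -
  let ?q = "sqrt_iter (1 - y)"
  obtain q where q: "?q \<longlonglongrightarrow> q"
    using convergent_sqrt_iter[OF le] unfolding convergent_def by blast
  have "(\<lambda>n. ?q (Suc n)) \<longlonglongrightarrow> (1/2) *\<^sub>R ((1 - y) + q * q)"
    unfolding sqrt_iter.simps by (intro tendsto_intros q)
  then have "q = (1/2) *\<^sub>R ((1 - y) + q * q)"
    using LIMSEQ_unique LIMSEQ_Suc[OF q] by blast
  then have "2 *\<^sub>R q = 2 *\<^sub>R ((1/2) *\<^sub>R ((1 - y) + q * q))" by simp
  then have fix_eq: "q + q = (1 - y) + q * q" by (simp add: scaleR_2)
  have "invol (?q n) = ?q n" for n
    using sa by (induction n) (auto simp: self_adjoint_def)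
  then have "?q \<longlonglongrightarrow> invol q" using tendsto_invol[OF q] by simp
  then have iq: "invol q = q" using q by (rule LIMSEQ_unique)
  have nq: "norm q \<le> 1"
  proof (rule Lim_bounded[OF tendsto_norm[OF q], of 0], intro allI impI)
    show "norm (?q n) \<le> 1" for n
      using norm_sqrt_iter_le[OF le, of n] sqrt_iter_one_bounds[of n] by linarith
  qed
  have cq: "w * q = q * w" if "w * y = y * w" for w
  proof -
    have eq: "w * ?q n = ?q n * w" for n
      by (rule sqrt_iter_commute) (simp add: that left_diff_distrib right_diff_distrib)
    show ?thesis
      using tendsto_mult_right[OF q, of w] LIMSEQ_unique[OF tendsto_mult_left[OF q, of w]]
      unfolding eq by blast
  qed
  show ?thesis
  proof (rule that[of "1 - q"])
    show "self_adjoint (1 - q)" using iq by (simp add: self_adjoint_def)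
    show "(1 - q) * (1 - q) = y" using fix_eq by (simp add: algebra_simps)
    show "norm (1 - (1 - q)) \<le> 1" using nq by simp
    show "w * (1 - q) = (1 - q) * w" if "w * y = y * w" for w
      using cq[OF that] by (simp add: left_diff_distrib right_diff_distrib)
  qed
qed

text \<open>Apply the C*-identity to \<open>u = p + i q\<close>: commutativity gives
  \<open>invol u * u = p * p + q * q\<close>, and \<open>u + invol u = 2 p\<close> gives
  \<open>norm p \<le> norm u\<close>.\<close>

lemma norm_le_add_squares:
  fixes p q :: "'a::unital_cstar_algebra"
  assumes "self_adjoint p" "self_adjoint q" "p * q = q * p"
  shows "norm p * norm p \<le> norm (p * p + q * q)"
proof -
  let ?u = "p + scaleC \<i> q"
  have iv: "invol ?u = p + scaleC (-\<i>) q" using assms by (simp add: self_adjoint_def)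
  have "scaleC \<i> q + scaleC (-\<i>) q = 0"
    using scaleC_add_left[of \<i> "-\<i>" q] by (simp add: scaleC_zero_left)
  then have "?u + invol ?u = 2 *\<^sub>R p" unfolding iv
    by (simp add: scaleR_2 add.assoc add.left_commute)
  then have "2 * norm p \<le> norm ?u + norm (invol ?u)"
    by (metis norm_triangle_ineq norm_scaleR abs_numeral)
  then have "norm p \<le> norm ?u" by (simp only: norm_invol)
  then have "norm p * norm p \<le> (norm ?u)\<^sup>2" by (simp add: power2_eq_square mult_mono)
  also have "\<dots> = norm (invol ?u * ?u)" by (rule cstar_identity[symmetric])
  also have "invol ?u * ?u = p * p + q * q + (scaleC \<i> (p * q) + scaleC (-\<i>) (q * p))"
    unfolding iv by (simp add: distrib_left distrib_right scaleC_mult_left scaleC_mult_right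
        scaleC_add_right scaleC_scaleC scaleC_one)
  also have "scaleC \<i> (p * q) + scaleC (-\<i>) (q * p) = 0"
    using scaleC_add_left[of \<i> "-\<i>" "q * p"] assms(3) by (simp add: scaleC_zero_left)
  finally show ?thesis by simp
qed

text \<open>\<open>1 - h * h\<close> lies within distance 1 of \<open>1\<close>, so it is a square
  \<open>c * c\<close> with \<open>c\<close> self-adjoint and commuting with \<open>h\<close>. Then
  \<open>c * c + h * h = 1\<close> bounds the norm of \<open>c\<close>.\<close>

lemma norm_one_minus_square:
  fixes h :: "'a::unital_cstar_algebra"
  assumes "self_adjoint h" "norm h \<le> 1"
  shows "norm (1 - h * h) \<le> 1"
proof -
  have "norm (h * h) \<le> 1" using assms by (simp add: norm_square_self_adjoint mult_le_one)
  then have "norm (1 - (1 - h * h)) \<le> 1" by simp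
  moreover have "self_adjoint (1 - h * h)" using assms(1) by (simp add: self_adjoint_def)
  ultimately obtain c where c: "self_adjoint c" "c * c = 1 - h * h"
      "\<And>w. w * (1 - h * h) = (1 - h * h) * w \<Longrightarrow> w * c = c * w"
    using sqrt_exists by metis
  have "c * h = h * c" by (rule c(3)[symmetric]) (simp add: algebra_simps)
  then have "norm c * norm c \<le> norm (c * c + h * h)"
    by (rule norm_le_add_squares[OF c(1) assms(1)])
  then show ?thesis using norm_square_self_adjoint[OF c(1)] c(2) by simp
qed

section \<open>The cone of positive elements, described by the norm\<close>

text \<open>In spectral terms the inequality places the spectrum in \<open>[0, 2r]\<close>. The
  radius is strictly positive so that dividing by it reduces to the case
  \<open>r = 1\<close>.\<close>

definition norm_positive :: "'a::unital_cstar_algebra \<Rightarrow> bool" where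
  "norm_positive x \<longleftrightarrow> self_adjoint x \<and> (\<exists>r>0. norm (of_real r - x) \<le> r)"

lemma norm_positive_add:
  assumes "norm_positive x" "norm_positive y"
  shows "norm_positive (x + y)"
proof -
  from assms obtain r s where rs: "r > 0" "s > 0" "norm (of_real r - x) \<le> r" "norm (of_real s - y) \<le> s"
    by (auto simp: norm_positive_def)
  have "of_real (r + s) - (x + y) = (of_real r - x) + (of_real s - y)" by simp
  then have "norm (of_real (r + s) - (x + y)) \<le> r + s"
    using rs by (metis norm_triangle_mono)
  then show ?thesis using assms rs
    by (auto simp: norm_positive_def self_adjoint_def intro!: exI[of _ "r + s"])
qed

lemma norm_positive_scaleR:
  assumes "norm_positive x" "k > 0"
  shows "norm_positive (k *\<^sub>R x)"
proof -
  from assms obtain r where r: "r > 0" "norm (of_real r - x) \<le> r"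
    by (auto simp: norm_positive_def)
  have "of_real (k * r) - k *\<^sub>R x = k *\<^sub>R (of_real r - x)"
    by (simp add: of_real_def scaleR_diff_right)
  then have "norm (of_real (k * r) - k *\<^sub>R x) \<le> k * r" using r assms(2) by simp
  moreover have "k * r > 0" using r assms(2) by simp
  ultimately show ?thesis using assms unfolding norm_positive_def
    by (auto simp: self_adjoint_def intro!: exI[of _ "k * r"])
qed

lemma norm_positive_square:
  assumes "self_adjoint h"
  shows "norm_positive (h * h)"
proof (cases "h = 0")
  case True
  then show ?thesis by (auto simp: norm_positive_def self_adjoint_def intro!: exI[of _ 1])
next
  case False
  \<comment> \<open>Normalising to norm 1 makes \<open>norm_one_minus_square\<close> a test with
    radius 1; multiplying by the squared norm undoes it.\<close>
  let ?k = "(1 / norm h) *\<^sub>R h"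
  have "norm (1 - ?k * ?k) \<le> 1"
    using assms False by (intro norm_one_minus_square) (auto simp: self_adjoint_def)
  then have "norm_positive (?k * ?k)"
    using assms by (auto simp: norm_positive_def self_adjoint_def intro!: exI[of _ 1])
  from norm_positive_scaleR[OF this, of "norm h * norm h"] show ?thesis
    using False by (simp add: zero_less_mult_iff)
qed

lemma norm_positive_sqrt:
  assumes "norm_positive (x::'a::unital_cstar_algebra)"
  obtains p where "norm_positive p" "p * p = x" "\<And>w. w * x = x * w \<Longrightarrow> w * p = p * w"
proof -
  from assms obtain r where r: "r > 0" "norm (of_real r - x) \<le> r" and sa: "self_adjoint x"
    by (auto simp: norm_positive_def)
  let ?y = "(1 / r) *\<^sub>R x"
  have "1 - ?y = (1 / r) *\<^sub>R (of_real r - x)"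
    using r(1) by (simp add: scaleR_diff_right of_real_def)
  then have "norm (1 - ?y) \<le> 1" using r by simp
  moreover have "self_adjoint ?y" using sa by (simp add: self_adjoint_def)
  ultimately obtain p where p: "self_adjoint p" "p * p = ?y" "norm (1 - p) \<le> 1"
    "\<And>w. w * ?y = ?y * w \<Longrightarrow> w * p = p * w"
    using sqrt_exists by metis
  have "norm_positive p" using p(1,3) by (auto simp: norm_positive_def intro!: exI[of _ 1])
  then have "norm_positive (sqrt r *\<^sub>R p)" using r by (intro norm_positive_scaleR) auto
  moreover have "(sqrt r *\<^sub>R p) * (sqrt r *\<^sub>R p) = x"
    using p(2) r(1) by simp
  moreover have "w * (sqrt r *\<^sub>R p) = (sqrt r *\<^sub>R p) * w" if "w * x = x * w" for w
    using p(4)[of w] that by simp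
  ultimately show ?thesis by (rule that)
qed

lemma norm_positive_self_adjoint: "norm_positive x \<Longrightarrow> self_adjoint x"
  by (simp add: norm_positive_def)

text \<open>The product is the square of \<open>p * q\<close> for the two square roots. These
  commute by two uses of the commutation clause: \<open>y\<close> commutes with \<open>x\<close>,
  hence with \<open>p\<close>; so \<open>p\<close> commutes with \<open>y\<close>, hence with
  \<open>q\<close>.\<close>

lemma norm_positive_mult:
  assumes "norm_positive x" "norm_positive y" "x * y = y * x"
  shows "norm_positive (x * y)"
proof -
  obtain p where p: "norm_positive p" "p * p = x" "\<And>w. w * x = x * w \<Longrightarrow> w * p = p * w"
    using norm_positive_sqrt[OF assms(1)] by metis
  obtain q where q: "norm_positive q" "q * q = y" "\<And>w. w * y = y * w \<Longrightarrow> w * q = q * w"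
    using norm_positive_sqrt[OF assms(2)] by metis
  have pq: "p * q = q * p" using p(3)[of y] q(3)[of p] assms(3) by simp
  have "self_adjoint (p * q)"
    using p(1) q(1) pq by (simp add: norm_positive_def self_adjoint_def)
  moreover have "(p * q) * (p * q) = x * y"
    unfolding p(2)[symmetric] q(2)[symmetric] using pq by (metis mult.assoc)
  ultimately show ?thesis using norm_positive_square[of "p * q"] by simp
qed

text \<open>This is \<open>norm_le_add_squares\<close> for the commuting square roots of
  \<open>x\<close> and \<open>y\<close>.\<close>

lemma norm_positive_norm_mono:
  assumes "norm_positive x" "norm_positive y" "x * y = y * x"
  shows "norm x \<le> norm (x + y)"
proof -
  obtain p where p: "norm_positive p" "p * p = x" "\<And>w. w * x = x * w \<Longrightarrow> w * p = p * w"
    using norm_positive_sqrt[OF assms(1)] by metis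
  obtain q where q: "norm_positive q" "q * q = y" "\<And>w. w * y = y * w \<Longrightarrow> w * q = q * w"
    using norm_positive_sqrt[OF assms(2)] by metis
  have pq: "p * q = q * p" using p(3)[of y] q(3)[of p] assms(3) by simp
  show ?thesis
    using norm_le_add_squares[OF norm_positive_self_adjoint[OF p(1)] norm_positive_self_adjoint[OF q(1)] pq]
      norm_square_self_adjoint[OF norm_positive_self_adjoint[OF p(1)]]
    by (simp only: p(2) q(2))
qed

lemma norm_positive_antisym:
  assumes "norm_positive x" "norm_positive (- x)"
  shows "x = 0"
proof -
  have "norm x \<le> norm (x + - x)" by (rule norm_positive_norm_mono[OF assms]) simp
  then show ?thesis by simp
qed

lemma norm_positive_zero: "norm_positive 0"
  using norm_positive_square[of 0] by (simp add: self_adjoint_def)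

lemma norm_positive_scaleR_nonneg:
  assumes "norm_positive x" "k \<ge> 0"
  shows "norm_positive (k *\<^sub>R x)"
proof (cases "k = 0")
  case True
  then show ?thesis by (simp add: norm_positive_zero)
next
  case False
  then show ?thesis using assms by (simp add: norm_positive_scaleR)
qed

lemma norm_positive_one: "norm_positive 1"
  using norm_positive_square[of 1] by (simp add: self_adjoint_def)

section \<open>Positivity of \<open>invol z * z\<close>\<close>

text \<open>Bernoulli's inequality \<open>(1 + x)^n \<ge> 1 + n x\<close>, multiplied by
  \<open>x\<close>. In the induction the old difference times \<open>1 + x\<close>, plus the
  positive term \<open>n x^3\<close>, is exactly the new difference.\<close>

lemma norm_positive_power_diff:
  assumes "norm_positive x"
  shows "norm_positive (x * (1 + x) ^ n - (x + real n *\<^sub>R (x * x)))"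
proof (induction n)
  case 0
  then show ?case by (simp add: norm_positive_zero)
next
  case (Suc n)
  let ?d = "x * (1 + x) ^ n - (x + real n *\<^sub>R (x * x))"
  have K: "(1 + x) ^ n * x = x * (1 + x) ^ n"
    by (rule power_commuting_commutes) (simp add: algebra_simps)
  have "norm_positive (x * (x * x))"
    using assms by (intro norm_positive_mult norm_positive_square norm_positive_self_adjoint)
       (auto simp: mult.assoc)
  then have "norm_positive (real n *\<^sub>R (x * (x * x)))" by (rule norm_positive_scaleR_nonneg) simp
  moreover have "?d * x = x * ?d" using K by (simp add: algebra_simps)
  then have "norm_positive (?d * (1 + x))"
    using Suc assms by (intro norm_positive_mult norm_positive_add norm_positive_one)
      (auto simp: algebra_simps)
  ultimately have "norm_positive (?d * (1 + x) + real n *\<^sub>R (x * (x * x)))"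
    by (intro norm_positive_add)
  also have "?d * (1 + x) + real n *\<^sub>R (x * (x * x))
      = x * (1 + x) ^ Suc n - (x + real (Suc n) *\<^sub>R (x * x))"
    unfolding power_Suc2 by (simp add: algebra_simps)
  finally show ?case .
qed

text \<open>The heart of the Kelley--Vaught theorem.  The powers of $1 + g^2/r$, sandwiched as
  $v^*(r - vv^*)^n v = v^*v\,(r - v^*v)^n$, stay bounded, whereas $g^2(1+g^2/r)^n$ grows at
  least linearly in $n$.\<close>

lemma eq_0_if_opposite_signs:
  fixes v :: "'a::unital_cstar_algebra"
  assumes g: "self_adjoint g" "invol v * v = - (g * g)" and pos: "norm_positive (v * invol v)"
  shows "v = 0"
proof -
  obtain r where r: "r > 0" "norm (of_real r - v * invol v) \<le> r"
    using pos by (auto simp: norm_positive_def)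
  define x where "x = (1 / r) *\<^sub>R (g * g)"
  have xpos: "norm_positive x"
    unfolding x_def using r(1) g(1) by (intro norm_positive_scaleR norm_positive_square) auto
  have gg: "g * g = r *\<^sub>R x" using r(1) by (simp add: x_def)
  let ?\<beta> = "1 - (1 / r) *\<^sub>R (v * invol v)"
  have "norm ?\<beta> = norm ((1 / r) *\<^sub>R (of_real r - v * invol v))"
    using r(1) by (simp add: scaleR_diff_right of_real_def)
  then have \<beta>: "norm ?\<beta> \<le> 1" using r by simp
  \<comment> \<open>Since \<open>invol v * v = - (g * g)\<close>, moving the contraction past
    \<open>v\<close> turns its minus sign into a plus, so powers of \<open>1 + x\<close> to the
    right of \<open>v\<close> are powers of a contraction to its left.\<close>
  have step: "?\<beta> * v = v * (1 + x)"
    using g(2) r(1) by (simp add: algebra_simps gg)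
  have intertwine: "?\<beta> ^ n * v = v * (1 + x) ^ n" for n
  proof (induction n)
    case (Suc n)
    have "?\<beta> ^ Suc n * v = ?\<beta> ^ n * (?\<beta> * v)" by (simp only: power_Suc2 mult.assoc)
    also have "\<dots> = (?\<beta> ^ n * v) * (1 + x)" by (simp only: step mult.assoc)
    also have "\<dots> = v * (1 + x) ^ Suc n" by (simp only: Suc power_Suc2 mult.assoc)
    finally show ?case .
  qed simp
  have bound: "norm (x * (1 + x) ^ n) \<le> (norm v)\<^sup>2 / r" for n
  proof -
    have "r * norm (x * (1 + x) ^ n) = norm (invol v * v * (1 + x) ^ n)"
      using r(1) by (simp add: g(2) gg)
    also have "\<dots> = norm (invol v * (?\<beta> ^ n * v))" by (simp only: intertwine mult.assoc)
    also have "\<dots> \<le> norm (invol v) * (norm (?\<beta> ^ n) * norm v)"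
      by (meson norm_mult_ineq mult_left_mono norm_ge_zero order_trans)
    also have "\<dots> \<le> norm v * (1 * norm v)"
    proof -
      have "norm (?\<beta> ^ n) \<le> 1"
        using norm_power_ineq[of ?\<beta> n] power_le_one[OF norm_ge_zero \<beta>, of n] by linarith
      then show ?thesis by (simp add: mult_left_mono mult_left_le_one_le)
    qed
    finally show ?thesis using r(1) by (simp add: field_simps power2_eq_square)
  qed
  have growth: "real n * norm (x * x) \<le> (norm v)\<^sup>2 / r" for n
  proof -
    let ?d = "x * (1 + x) ^ n - (x + real n *\<^sub>R (x * x))"
    have xx: "norm_positive (real n *\<^sub>R (x * x))"
      using xpos by (intro norm_positive_scaleR_nonneg norm_positive_square norm_positive_self_adjoint) auto
    have K: "(1 + x) ^ n * x = x * (1 + x) ^ n"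
      by (rule power_commuting_commutes) (simp add: algebra_simps)
    have K2: "(1 + x) ^ n * (x * x) = x * (x * (1 + x) ^ n)"
      by (metis K mult.assoc)
    \<comment> \<open>\<open>x * (1 + x)^n\<close> splits into the commuting positive summands
      \<open>n x^2\<close> and \<open>x + ?d\<close>, so its norm dominates that of the
      first.\<close>
    have "norm_positive (x + ?d)"
      using xpos norm_positive_power_diff by (intro norm_positive_add)
    moreover have "real n *\<^sub>R (x * x) * (x + ?d) = (x + ?d) * (real n *\<^sub>R (x * x))"
      using K2 by (simp add: algebra_simps)
    ultimately have "norm (real n *\<^sub>R (x * x)) \<le> norm (real n *\<^sub>R (x * x) + (x + ?d))"
      using xx by (intro norm_positive_norm_mono)
    also have "real n *\<^sub>R (x * x) + (x + ?d) = x * (1 + x) ^ n" by simp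
    finally show ?thesis using bound[of n] by simp
  qed
  have "norm (x * x) = 0"
  proof (rule ccontr)
    assume "norm (x * x) \<noteq> 0"
    then have "norm (x * x) > 0" by simp
    then obtain n where "(norm v)\<^sup>2 / r < real n * norm (x * x)"
      using reals_Archimedean3 by blast
    then show False using growth[of n] by simp
  qed
  then have "norm x = 0"
    using norm_square_self_adjoint[OF norm_positive_self_adjoint[OF xpos]] by simp
  then show ?thesis using g(2) gg by simp
qed

text \<open>Up to scalars \<open>a\<close> and \<open>b\<close> are the real and imaginary parts of
  \<open>v\<close>. In \<open>a * a + b * b\<close> the terms \<open>v * v\<close> and
  \<open>invol v * invol v\<close> cancel, leaving twice the element in question.\<close>

lemma norm_positive_mult_add_swap:
  fixes v :: "'a::unital_cstar_algebra"
  shows "norm_positive (invol v * v + v * invol v)"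
proof -
  define a where "a = v + invol v"
  define b where "b = scaleC \<i> (v - invol v)"
  have neg: "scaleC (- \<i>) y = - scaleC \<i> y" for y :: 'a
    using scaleC_add_left[of \<i> "-\<i>" y] by (simp add: scaleC_zero_left eq_neg_iff_add_eq_0 add.commute)
  have minus: "scaleC \<i> (- y) = - scaleC \<i> y" for y :: 'a
    using scaleC_add_right[of \<i> y "-y"] scaleC_add_right[of \<i> 0 "0::'a"]
    by (simp add: eq_neg_iff_add_eq_0 add.commute)
  have "self_adjoint a" by (simp add: a_def self_adjoint_def add.commute)
  moreover have "invol b = - scaleC \<i> (- (v - invol v))"
    unfolding b_def by (simp add: neg)
  then have "self_adjoint b" unfolding self_adjoint_def by (simp only: minus minus_minus b_def)
  moreover have "b * b = - ((v - invol v) * (v - invol v))"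
    by (simp add: b_def scaleC_mult_left scaleC_mult_right scaleC_scaleC scaleC_minus_one)
  then have "a * a + b * b = 2 *\<^sub>R (invol v * v + v * invol v)"
    by (simp add: a_def algebra_simps scaleR_2)
  then have "invol v * v + v * invol v = (1/2) *\<^sub>R (a * a + b * b)" by simp
  ultimately show ?thesis
    by (simp only:) (intro norm_positive_scaleR norm_positive_add norm_positive_square; simp)
qed

text \<open>Here \<open>p\<close> is the absolute value of \<open>y = invol z * z\<close> and
  \<open>w = p - y\<close> is twice its negative part. With \<open>v = z * w\<close>, the element
  \<open>invol v * v\<close> is negative while \<open>v * invol v\<close> is positive, so
  \<open>v\<close> vanishes; this forces \<open>w = 0\<close> and \<open>y = p\<close>.\<close>

lemma norm_positive_invol_mult:
  fixes z :: "'a::unital_cstar_algebra"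
  shows "norm_positive (invol z * z)"
proof -
  define y where "y = invol z * z"
  have y: "self_adjoint y" by (simp add: y_def self_adjoint_def)
  obtain p where p: "norm_positive p" "p * p = y * y" "\<And>w. w * (y * y) = y * y * w \<Longrightarrow> w * p = p * w"
    using norm_positive_sqrt[OF norm_positive_square[OF y]] by metis
  have yp: "y * p = p * y" by (rule p(3)) (simp add: mult.assoc)
  define w where "w = p - y"
  have w: "invol w = w" using p(1) y by (simp add: w_def norm_positive_def self_adjoint_def)
  have yw: "y * w = - (p * w)" using p(2) yp by (simp add: w_def algebra_simps)
  have pw: "p * w = w * p" using yp by (simp add: w_def algebra_simps)
  \<comment> \<open>A square root of \<open>p\<close> displays \<open>p * w * w\<close> as the
    square of the self-adjoint \<open>k * w\<close>, the form that
    \<open>eq_0_if_opposite_signs\<close> takes.\<close>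
  obtain k where k: "norm_positive k" "k * k = p" "\<And>u. u * p = p * u \<Longrightarrow> u * k = k * u"
    using norm_positive_sqrt[OF p(1)] by metis
  have wk: "w * k = k * w" by (rule k(3)) (simp add: pw)
  have kw: "self_adjoint (k * w)"
    using k(1) wk w by (simp add: norm_positive_def self_adjoint_def)
  have "k * w * (k * w) = k * k * w * w" by (metis wk mult.assoc)
  then have kk: "k * w * (k * w) = p * w * w" by (simp only: k(2))
  define v where "v = z * w"
  have "invol v * v = w * (y * w)" by (simp add: v_def w y_def mult.assoc)
  also have "\<dots> = - (p * w * w)" by (simp add: yw) (metis pw mult.assoc)
  finally have v: "invol v * v = - (k * w * (k * w))" by (simp add: kk)
  \<comment> \<open>The added square cancels \<open>invol v * v\<close>, so what remains is
    \<open>v * invol v\<close>.\<close>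
  have "norm_positive ((invol v * v + v * invol v) + k * w * (k * w))"
    by (intro norm_positive_add norm_positive_mult_add_swap norm_positive_square kw)
  then have "norm_positive (v * invol v)" by (simp add: v)
  then have "v = 0" by (rule eq_0_if_opposite_signs[OF kw v])
  then have "y * w = 0" by (simp add: v_def y_def mult.assoc)
  then have "w * w = 0" using yw by (simp add: w_def left_diff_distrib)
  then have "w = 0" using invol_mult_self_eq_0[of w] w by simp
  then show ?thesis using p(1) by (simp add: w_def y_def)
qed

lemma positive_iff_norm_positive: "positive x \<longleftrightarrow> norm_positive x"
proof
  assume "norm_positive x"
  then obtain p where "norm_positive p" "p * p = x" by (rule norm_positive_sqrt)
  then show "positive x"
    by (auto simp: positive_def norm_positive_def self_adjoint_def intro!: exI[of _ p])
qed (auto simp: positive_def norm_positive_invol_mult)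

section \<open>Maximal commuting sets\<close>

text \<open>With no algebra operations in the definition, a set is enlarged simply by adjoining an
  element and its adjoint. Maximality supplies closure under the operations afterwards.\<close>

definition commuting_star :: "'a::unital_cstar_algebra set \<Rightarrow> bool" where
  "commuting_star S \<longleftrightarrow> abelian S \<and> (\<forall>x\<in>S. invol x \<in> S)"

text \<open>The ambient set \<open>X\<close> will be the annihilator of \<open>h\<close> once, and
  the whole algebra once.\<close>

definition maximal_commuting :: "'a::unital_cstar_algebra set \<Rightarrow> 'a set \<Rightarrow> bool" where
  "maximal_commuting X S \<longleftrightarrow> S \<subseteq> X \<and> commuting_star S \<and>
     (\<forall>T. commuting_star T \<and> S \<subseteq> T \<and> T \<subseteq> X \<longrightarrow> T = S)"

lemma maximal_commuting_exists:
  assumes "commuting_star S" "S \<subseteq> X"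
  obtains M where "S \<subseteq> M" "maximal_commuting X M"
proof -
  let ?A = "{T. commuting_star T \<and> S \<subseteq> T \<and> T \<subseteq> X}"
  have "\<exists>M\<in>?A. \<forall>T\<in>?A. M \<subseteq> T \<longrightarrow> T = M"
  proof (rule subset_Zorn_nonempty)
    show "?A \<noteq> {}" using assms by auto
  next
    fix C assume C: "C \<noteq> {}" "subset.chain ?A C"
    have sub: "T \<in> ?A" if "T \<in> C" for T using C(2) that by (auto simp: subset.chain_def)
    have "x * y = y * x" if xy: "x \<in> \<Union>C" "y \<in> \<Union>C" for x y
    proof -
      obtain T U where TU: "T \<in> C" "x \<in> T" "U \<in> C" "y \<in> U" using xy by blast
      then have "T \<subseteq> U \<or> U \<subseteq> T" using C(2) by (auto simp: subset_chain_def)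
      then obtain V where "V \<in> C" "x \<in> V" "y \<in> V" using TU by blast
      then show ?thesis using sub[of V] by (auto simp: commuting_star_def abelian_def)
    qed
    moreover have "invol x \<in> \<Union>C" if "x \<in> \<Union>C" for x
      using that sub by (fastforce simp: commuting_star_def)
    ultimately have "commuting_star (\<Union>C)" unfolding commuting_star_def abelian_def by blast
    then show "\<Union>C \<in> ?A" using sub C(1) by blast
  qed
  then obtain M where M: "M \<in> ?A" "\<forall>T\<in>?A. M \<subseteq> T \<longrightarrow> T = M" by (rule bexE)
  have "maximal_commuting X M"
    unfolding maximal_commuting_def
  proof (intro conjI allI impI)
    fix T assume "commuting_star T \<and> M \<subseteq> T \<and> T \<subseteq> X"
    moreover then have "T \<in> ?A" using M(1) by auto
    ultimately show "T = M" using M(2) by simp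
  qed (use M(1) in auto)
  then show ?thesis using M(1) by (intro that[of M]) auto
qed

text \<open>If \<open>y\<close> commutes with the *-closed \<open>M\<close>, then so does
  \<open>invol y\<close>, by taking adjoints. As \<open>y\<close> is normal, adjoining both keeps
  the set commuting, and maximality absorbs them.\<close>

lemma maximal_commuting_mem:
  assumes M: "maximal_commuting X M" and X: "star_subalgebra X"
    and y: "y \<in> X" "invol y * y = y * invol y" "\<And>m. m \<in> M \<Longrightarrow> y * m = m * y"
  shows "y \<in> M"
proof -
  let ?T = "insert y (insert (invol y) M)"
  have star: "invol m \<in> M" if "m \<in> M" for m
    using M that by (auto simp: maximal_commuting_def commuting_star_def)
  have comm: "m * n = n * m" if "m \<in> M" "n \<in> M" for m n
    using M that by (auto simp: maximal_commuting_def commuting_star_def abelian_def)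
  have iy: "invol y * m = m * invol y" if "m \<in> M" for m
  proof -
    have "invol (y * invol m) = invol (invol m * y)" using y(3)[OF star[OF that]] by simp
    then show ?thesis by simp
  qed
  have "abelian ?T"
    unfolding abelian_def using y(2,3) iy comm by (metis insertE)
  moreover have "\<forall>x\<in>?T. invol x \<in> ?T" using star by auto
  ultimately have "commuting_star ?T" unfolding commuting_star_def ..
  moreover have "?T \<subseteq> X"
    using M X y(1) by (auto simp: maximal_commuting_def star_subalgebra_def)
  ultimately have "?T = M"
    using M unfolding maximal_commuting_def by blast
  then show ?thesis by blast
qed

lemma scaleC_mult_commute:
  "scaleC a x * (y::'a::unital_cstar_algebra) = y * scaleC a x" if "x * y = y * x"
  using that by (simp add: scaleC_mult_left scaleC_mult_right)

text \<open>Sums, products and multiples of members commute with \<open>M\<close>, in particular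
  with the adjoints of members; this gives the normality that \<open>maximal_commuting_mem\<close>
  asks for.\<close>

lemma star_subalgebra_maximal_commuting:
  assumes M: "maximal_commuting X M" and X: "star_subalgebra X"
  shows "star_subalgebra M"
proof -
  have star: "invol m \<in> M" if "m \<in> M" for m
    using M that by (auto simp: maximal_commuting_def commuting_star_def)
  have comm: "m * n = n * m" if "m \<in> M" "n \<in> M" for m n
    using M that by (auto simp: maximal_commuting_def commuting_star_def abelian_def)
  have MX: "m \<in> X" if "m \<in> M" for m using M that by (auto simp: maximal_commuting_def)
  have "0 \<in> M"
    by (rule maximal_commuting_mem[OF M X]) (use X in \<open>auto simp: star_subalgebra_def\<close>)
  moreover have "x + y \<in> M" if "x \<in> M" "y \<in> M" for x y
  proof (rule maximal_commuting_mem[OF M X])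
    show "x + y \<in> X" using X MX that by (auto simp: star_subalgebra_def)
    show c: "(x + y) * m = m * (x + y)" if "m \<in> M" for m
      using comm that \<open>x \<in> M\<close> \<open>y \<in> M\<close> by (simp add: distrib_left distrib_right)
    show "invol (x + y) * (x + y) = (x + y) * invol (x + y)"
      using c[OF star[OF \<open>x \<in> M\<close>]] c[OF star[OF \<open>y \<in> M\<close>]] by (simp add: distrib_left distrib_right)
  qed
  moreover have "x * y \<in> M" if "x \<in> M" "y \<in> M" for x y
  proof (rule maximal_commuting_mem[OF M X])
    show "x * y \<in> X" using X MX that by (auto simp: star_subalgebra_def)
    show c: "(x * y) * m = m * (x * y)" if "m \<in> M" for m
      using comm[OF that \<open>x \<in> M\<close>] comm[OF that \<open>y \<in> M\<close>] by (metis mult.assoc)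
    have "(x * y) * (invol y * invol x) = invol y * (x * y) * invol x"
      using c[OF star[OF \<open>y \<in> M\<close>]] by (simp only: mult.assoc[symmetric])
    then show "invol (x * y) * (x * y) = (x * y) * invol (x * y)"
      using c[OF star[OF \<open>x \<in> M\<close>]] by (simp only: mult.assoc invol_mult)
  qed
  moreover have "scaleC a x \<in> M" if "x \<in> M" for a x
  proof (rule maximal_commuting_mem[OF M X])
    show "scaleC a x \<in> X" using X MX that by (auto simp: star_subalgebra_def)
    show "scaleC a x * m = m * scaleC a x" if "m \<in> M" for m
      using comm[OF \<open>x \<in> M\<close> that] by (rule scaleC_mult_commute)
    show "invol (scaleC a x) * scaleC a x = scaleC a x * invol (scaleC a x)"
      using comm[OF star[OF that] that]
      by (simp add: scaleC_mult_left scaleC_mult_right scaleC_scaleC mult.commute)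
  qed
  ultimately show ?thesis using star by (simp add: star_subalgebra_def)
qed

text \<open>An abelian *-subalgebra is a commuting *-closed set, so maximality among the latter
  gives maximality among the former.\<close>

lemma masa_maximal_commuting:
  assumes M: "maximal_commuting UNIV M"
  shows "masa M"
proof -
  have "star_subalgebra (UNIV :: 'a set)" by (simp add: star_subalgebra_def)
  then have "star_subalgebra M" by (rule star_subalgebra_maximal_commuting[OF M])
  moreover have "N = M" if "star_subalgebra N" "abelian N" "M \<subseteq> N" for N
    using M that by (auto simp: maximal_commuting_def commuting_star_def star_subalgebra_def)
  ultimately show ?thesis
    using M by (auto simp: masa_def maximal_commuting_def commuting_star_def)
qed

section \<open>Annihilating projections\<close>

lemma power_mult_eq_if_annihilated:
  fixes h z :: "'a::ring_1"
  assumes "h * z = 0"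
  shows "(1 - h * h) ^ n * z = z"
proof (induction n)
  case (Suc n)
  have "(1 - h * h) * z = z" using assms by (simp add: left_diff_distrib mult.assoc)
  then show ?case using Suc by (simp only: power_Suc2 mult.assoc)
qed simp

text \<open>In a function algebra, $(1-h^2)^n$ decreases to the indicator function of the zero set
  of $h$; its infimum in the masa is the annihilating projection.\<close>

lemma masa_annihilating_projection:
  fixes h :: "'a::unital_cstar_algebra"
  assumes masa: "masa M" and compl: "monotone_sigma_complete M" and one: "1 \<in> M"
    and h: "h \<in> M" "self_adjoint h" "norm h \<le> 1"
  obtains e where "e \<in> M" "projection e" "h * e = 0" "\<And>j. j \<in> M \<Longrightarrow> h * j = 0 \<Longrightarrow> j * e = j"
proof -
  have comm: "x * y = y * x" if "x \<in> M" "y \<in> M" for x y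
    using masa that by (simp add: masa_def abelian_def)
  have sub: "star_subalgebra M" using masa by (simp add: masa_def)
  have addM: "x + y \<in> M" and multM: "x * y \<in> M" if "x \<in> M" "y \<in> M" for x y
    using sub that by (auto simp: star_subalgebra_def)
  have invM: "invol x \<in> M" if "x \<in> M" for x using sub that by (auto simp: star_subalgebra_def)
  have scM: "r *\<^sub>R x \<in> M" if "x \<in> M" for r x
    using sub that scaleC_of_real[of r x] by (metis star_subalgebra_def)
  have diffM: "x - y \<in> M" if "x \<in> M" "y \<in> M" for x y
    using addM[OF that(1) scM[OF that(2), of "-1"]] by simp
  define d where "d = 1 - h * h"
  have hh: "norm_positive (h * h)" by (rule norm_positive_square[OF h(2)])
  have dM: "d \<in> M" unfolding d_def by (intro diffM multM one h)
  have dnM: "d ^ n \<in> M" for n by (induction n) (auto intro: one multM dM)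
  have nd: "norm d \<le> 1" unfolding d_def by (rule norm_one_minus_square[OF h(2,3)])
  have "norm (h * h) \<le> 1" using h by (simp add: norm_square_self_adjoint mult_le_one)
  then have dpos: "norm_positive d" using h(2)
    by (auto simp: norm_positive_def d_def self_adjoint_def intro!: exI[of _ 1])
  have dnpos: "norm_positive (d ^ n)" for n
    by (induction n) (auto intro: norm_positive_one norm_positive_mult dpos comm dM dnM)
  have d_Suc: "d ^ Suc n = d ^ n - d ^ n * (h * h)" for n
    by (simp add: power_Suc2 d_def right_diff_distrib del: power_Suc)
  \<comment> \<open>Completeness speaks of increasing sequences, so the decreasing powers are
    reflected in \<open>1\<close>; the infimum is then \<open>e = 1 - s\<close>.\<close>
  let ?b = "\<lambda>n. 1 - d ^ n"
  have "?b n \<in> M \<and> self_adjoint (?b n)" for n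
    using norm_positive_self_adjoint[OF dnpos[of n]] by (auto intro: diffM one dnM simp: self_adjoint_def)
  moreover have "cle (?b n) (?b (Suc n))" for n
    unfolding cle_def positive_iff_norm_positive d_Suc
    by (simp, intro norm_positive_mult dnpos hh comm dnM multM h)
  moreover have "norm (?b n) \<le> 2" for n
  proof -
    have "norm (d ^ n) \<le> 1"
      using norm_power_ineq[of d n] power_le_one[OF norm_ge_zero nd, of n] by linarith
    then show ?thesis using norm_triangle_ineq4[of 1 "d ^ n"] by simp
  qed
  ultimately obtain s where s: "s \<in> M" "self_adjoint s" "\<And>n. cle (?b n) s"
      "\<And>t. t \<in> M \<Longrightarrow> self_adjoint t \<Longrightarrow> (\<And>n. cle (?b n) t) \<Longrightarrow> cle s t"
    using compl[unfolded monotone_sigma_complete_def, rule_format, of ?b] by blast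
  define e where "e = 1 - s"
  have eM: "e \<in> M" unfolding e_def by (intro diffM one s)
  have esa: "invol e = e" using s(2) by (simp add: e_def self_adjoint_def)
  have lower: "norm_positive (d ^ n - e)" for n
    using s(3)[of n] by (simp add: cle_def positive_iff_norm_positive e_def algebra_simps)
  have greatest: "norm_positive (e - t)" if "t \<in> M" "\<And>n. norm_positive (d ^ n - t)" for t
  proof -
    have "self_adjoint t" using norm_positive_self_adjoint[OF that(2)[of 0]]
      by (simp add: self_adjoint_def)
    then have "cle s (1 - t)"
      using that by (intro s(4) diffM one)
        (auto simp: cle_def positive_iff_norm_positive self_adjoint_def algebra_simps)
    then show ?thesis by (simp add: cle_def positive_iff_norm_positive e_def algebra_simps)
  qed
  have epos: "norm_positive e"
    using greatest[of 0] dnpos sub by (simp add: star_subalgebra_def)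
  have ecpos: "norm_positive (1 - e)" using lower[of 0] by simp
  have hhM: "h * h \<in> M" by (intro multM h)
  \<comment> \<open>Combining the lower bounds at \<open>n\<close> and at \<open>Suc n\<close> shows
    that \<open>e + e * (h * h)\<close> is again a lower bound. As \<open>e\<close> is the greatest
    one, \<open>- (e * (h * h))\<close> is positive, hence zero by antisymmetry.\<close>
  have "norm_positive (d ^ n - (e + e * (h * h)))" for n
  proof -
    have "norm_positive ((d ^ n - e) * (h * h) + (d ^ Suc n - e))"
      by (intro norm_positive_add norm_positive_mult lower hh comm diffM dnM eM hhM)
    also have "(d ^ n - e) * (h * h) + (d ^ Suc n - e) = d ^ n - (e + e * (h * h))"
      unfolding d_Suc by (simp add: left_diff_distrib)
    finally show ?thesis .
  qed
  then have "norm_positive (e - (e + e * (h * h)))" by (intro greatest addM multM eM h)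
  moreover have "norm_positive (e * (h * h))" by (intro norm_positive_mult epos hh comm eM hhM)
  ultimately have "e * (h * h) = 0" by (intro norm_positive_antisym) auto
  moreover have "invol (e * h) * (e * h) = e * (e * (h * h))"
    using h(2) esa comm[OF h(1) eM] by (simp add: self_adjoint_def) (metis mult.assoc)
  ultimately have "e * h = 0" using invol_mult_self_eq_0[of "e * h"] by simp
  then have he: "h * e = 0" using comm[OF h(1) eM] by simp
  have unit_ball: "j * e = j" if j: "j \<in> M" "h * j = 0" "norm j \<le> 1" for j
  proof -
    define y where "y = invol j * j"
    have yM: "y \<in> M" unfolding y_def by (intro multM invM j)
    have "h * y = invol j * (h * j)"
      unfolding y_def using comm[OF h(1) invM[OF j(1)]] by (metis mult.assoc)
    then have hy: "h * y = 0" using j(2) by simp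
    have ypos: "norm_positive y" unfolding y_def by (rule norm_positive_invol_mult)
    have "norm y \<le> 1"
      using j(3) cstar_identity[of j] by (simp add: y_def power_le_one)
    then have ycpos: "norm_positive (1 - y)"
      using norm_positive_self_adjoint[OF ypos]
      by (auto simp: norm_positive_def self_adjoint_def intro!: exI[of _ 1])
    \<comment> \<open>For functions, \<open>e + y - e y = 1 - (1 - e)(1 - y)\<close> is a join of
      \<open>e\<close> and \<open>y\<close>. Both are fixed by multiplication with
      \<open>d ^ n\<close>, because \<open>h\<close> annihilates them, so the join is a lower bound
      too and cannot exceed \<open>e\<close>. The restriction to the unit ball serves to make
      \<open>1 - y\<close> positive.\<close>
    have "norm_positive (d ^ n - (e + y * (1 - e)))" for n
    proof -
      have "norm_positive (d ^ n * ((1 - e) * (1 - y)))"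
        by (intro norm_positive_mult dnpos ecpos ycpos comm diffM multM dnM one eM yM)
      also have "d ^ n * ((1 - e) * (1 - y)) = d ^ n - (d ^ n * e + (d ^ n * y - d ^ n * e * y))"
        by (simp add: algebra_simps)
      also have "\<dots> = d ^ n - (e + (y - e * y))"
        unfolding d_def power_mult_eq_if_annihilated[OF he] power_mult_eq_if_annihilated[OF hy] ..
      also have "\<dots> = d ^ n - (e + y * (1 - e))"
        using comm[OF eM yM] by (simp add: right_diff_distrib)
      finally show ?thesis .
    qed
    then have "norm_positive (e - (e + y * (1 - e)))"
      by (intro greatest addM multM diffM one eM yM)
    moreover have "norm_positive (y * (1 - e))"
      by (intro norm_positive_mult ypos ecpos comm yM diffM one eM)
    ultimately have y0: "y * (1 - e) = 0" by (intro norm_positive_antisym) auto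
    have "invol (j * (1 - e)) * (j * (1 - e)) = (1 - e) * (y * (1 - e))"
      by (simp add: esa y_def mult.assoc)
    then have "j * (1 - e) = 0" using y0 invol_mult_self_eq_0[of "j * (1 - e)"] by simp
    then show ?thesis by (simp add: right_diff_distrib)
  qed
  have unit: "j * e = j" if j: "j \<in> M" "h * j = 0" for j
  proof (cases "j = 0")
    case False
    let ?j = "(1 / norm j) *\<^sub>R j"
    have "?j * e = ?j" using False j by (intro unit_ball scM) auto
    then show ?thesis using False by simp
  qed simp
  \<comment> \<open>\<open>h\<close> annihilates \<open>e\<close>, so idempotence is the unit
    property for \<open>j = e\<close>.\<close>
  have "projection e" using unit[OF eM he] esa by (simp add: projection_def)
  then show ?thesis using that eM he unit by blast
qed

section \<open>From the masa to the whole algebra\<close>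

theorem theorem2p5:
  fixes x :: "'a :: unital_cstar_algebra"
  assumes "\<forall>M :: 'a set. masa M \<longrightarrow> monotone_sigma_complete M"
  shows "\<exists>f. projection f \<and> {z. x * z = 0} = {f * y | y. True}"
proof -
  define h where "h = (1 / (norm x)\<^sup>2) *\<^sub>R (invol x * x)"
  have hsa: "self_adjoint h" by (simp add: h_def self_adjoint_def)
  have hn: "norm h \<le> 1" by (simp add: h_def cstar_identity)
  have hx: "h * z = 0 \<longleftrightarrow> x * z = 0" for z
  proof
    assume "h * z = 0"
    then have "invol x * x * z = 0" by (cases "x = 0") (auto simp: h_def)
    then have "invol (x * z) * (x * z) = 0" by (simp add: mult.assoc)
    then show "x * z = 0" by (simp only: invol_mult_self_eq_0)
  qed (simp add: h_def mult.assoc)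
  \<comment> \<open>Annihilation on both sides makes \<open>X\<close> closed under the involution
    and lets \<open>h\<close> commute with every element of \<open>X\<close>, so that
    \<open>h\<close> can be adjoined to \<open>J\<close>.\<close>
  define X where "X = {z. h * z = 0 \<and> z * h = 0}"
  have X_star: "invol z \<in> X" if "z \<in> X" for z
  proof -
    have "invol (z * h) = 0" "invol (h * z) = 0" using that by (simp_all add: X_def del: invol_mult)
    then show ?thesis using hsa by (simp add: X_def self_adjoint_def)
  qed
  have X: "star_subalgebra X"
    unfolding star_subalgebra_def
  proof (intro conjI ballI allI)
    show "x * y \<in> X" if "x \<in> X" "y \<in> X" for x y
      using that by (simp add: X_def mult.assoc) (simp flip: mult.assoc)
    show "scaleC a x \<in> X" if "x \<in> X" for a x
      using that scaleC_add_right[of a 0 "0::'a"]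
      by (simp add: X_def scaleC_mult_left scaleC_mult_right)
  qed (auto simp: X_star, auto simp: X_def distrib_left distrib_right)
  obtain J where J: "maximal_commuting X J"
    by (rule maximal_commuting_exists[of "{}" X]) (auto simp: commuting_star_def abelian_def)
  then have JX: "J \<subseteq> X" and Jc: "commuting_star J" by (auto simp: maximal_commuting_def)
  have "commuting_star (insert h J)"
    using Jc JX hsa by (auto simp: commuting_star_def abelian_def self_adjoint_def X_def)
  then obtain M where JM: "insert h J \<subseteq> M" and M: "maximal_commuting UNIV M"
    using maximal_commuting_exists[of "insert h J" UNIV] by auto
  have masa: "masa M" by (rule masa_maximal_commuting[OF M])
  have one: "1 \<in> M"
    by (rule maximal_commuting_mem[OF M]) (auto simp: star_subalgebra_def)
  have comm: "a * b = b * a" if "a \<in> M" "b \<in> M" for a b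
    using masa that by (simp add: masa_def abelian_def)
  obtain e where e: "e \<in> M" "projection e" "h * e = 0" "\<And>j. j \<in> M \<Longrightarrow> h * j = 0 \<Longrightarrow> j * e = j"
    using masa_annihilating_projection[OF masa _ one _ hsa hn] assms masa JM by blast
  have ee: "e * e = e" "invol e = e" using e(2) by (auto simp: projection_def)
  have eh: "e * h = 0" using comm[OF e(1)] e(3) JM by auto
  have "e * z = z" if z: "h * z = 0" for z
  proof -
    define v where "v = (1 - e) * z"
    define w where "w = v * invol v"
    have w: "w = (1 - e) * (z * invol z * (1 - e))"
      by (simp add: w_def v_def ee mult.assoc)
    have wsa: "invol w = w" by (simp add: w_def)
    have "h * v = 0" using z e(3) by (simp add: v_def left_diff_distrib right_diff_distrib flip: mult.assoc)
    then have hw: "h * w = 0" by (simp add: w_def flip: mult.assoc)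
    \<comment> \<open>Taking adjoints in \<open>h * w = 0\<close> gives \<open>w * h = 0\<close>,
      since both factors are self-adjoint.\<close>
    then have "w \<in> X" using X_star wsa hsa
      by (metis (mono_tags, lifting) X_def invol_mult invol_zero mem_Collect_eq self_adjoint_def)
    \<comment> \<open>Both products vanish: \<open>e\<close> is a two-sided unit for
      \<open>j\<close>, while \<open>w\<close> carries the factor \<open>1 - e\<close> on either
      side.\<close>
    moreover have "w * j = j * w" if "j \<in> J" for j
    proof -
      have "j * e = j" using e(4)[of j] that JM JX by (auto simp: X_def)
      moreover then have "e * j = j" using comm[OF e(1), of j] that JM by auto
      ultimately have "(1 - e) * j = 0" "j * (1 - e) = 0" by (simp_all add: algebra_simps)
      then show ?thesis unfolding w by (simp add: mult.assoc) (simp flip: mult.assoc)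
    qed
    \<comment> \<open>Maximality of \<open>J\<close> within \<open>X\<close> puts \<open>w\<close>
      into \<open>M\<close>, where \<open>e\<close> acts on it as a unit; yet
      \<open>w * e = 0\<close> by construction.\<close>
    ultimately have "w \<in> J" using wsa by (intro maximal_commuting_mem[OF J X]) auto
    then have "w * e = w" using e(4)[OF _ hw] JM by auto
    moreover have "w * e = 0" by (simp add: w mult.assoc left_diff_distrib ee)
    ultimately have "invol (invol v) * invol v = 0" by (simp add: w_def)
    then have "v = 0" using invol_mult_self_eq_0[of "invol v"] by (metis invol_invol invol_zero)
    then show ?thesis by (simp add: v_def left_diff_distrib)
  qed
  then have "{z. h * z = 0} = {e * y | y. True}"
    using e(3) by (auto simp flip: mult.assoc) metis
  then show ?thesis using e(2) hx by auto
qed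

end
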